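(* Let $A$ be the signed adjacency matrix of an Adinkra with $N$ colors and vertex set $V$. Then the eigenvalues of $A$ are $\sqrt{N}$ and $-\sqrt{N}$, each of multiplicity $\frac{\#V}{2}$, and $A^2=NI$. Furthermore, $$\det A=\begin{cases} N^{\#V/2}, & N>1,\\ (-1)^{\#V/2}, & N=1.\end{cases}$$
   Context: A signed graph is a finite undirected simple graph $(V,E)$ with a signature $\mu:E\to\{-1,1\}$; edges with $\mu(e)=-1$ are called dashed, those with $\mu(e)=1$ solid. An Adinkra with $N\ge 1$ colors is a non-empty finite bipartite signed graph $(V,E,\mu)$ (with a fixed bipartition of $V$ into bosons and fermions, every edge joining a boson to a fermion), together with an assignment of one of $N$ colors to each edge and a function $h:V\to\mathbb{Z}$ (the function $h$ plays no role here), such that: (i) each vertex is incident to exactly $N$ edges, one of each color; (ii) for any two distinct colors, the subgraph consisting of all edges of those two colors is a disjoint union of $4$-cycles (called bicolor cycles); (iii) every bicolor cycle contains an odd number of dashed edges (the signature is "totally odd"); (iv) $|h(v)-h(w)|=1$ for adjacent $v,w$. An Adinkra need not be connected. The signed adjacency matrix $A$ (for an ordering of $V$) is the $\#V\times\#V$ symmetric matrix with $A_{ij}=\mu(e)$ if there is an edge $e$ between the $i$th and $j$th vertices, and $A_{ij}=0$ otherwise. *)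

theory Defs
  imports "Jordan_Normal_Form.Char_Poly"
begin

locale signed_graph =
  fixes V :: "'v set" and E :: "'v set set" and \<mu> :: "'v set \<Rightarrow> int"
  assumes finite_V: "finite V"
    and edge: "e \<in> E \<Longrightarrow> e \<subseteq> V \<and> card e = 2"
    and signature: "e \<in> E \<Longrightarrow> \<mu> e \<in> {-1, 1}"

text \<open>A 4-cycle is represented by its set of four edges.\<close>

definition four_cycle :: "'v set set \<Rightarrow> bool" where
  "four_cycle C \<longleftrightarrow>
     (\<exists>a b c d. distinct [a, b, c, d] \<and> C = {{a, b}, {b, c}, {c, d}, {d, a}})"

definition disjoint_union_of_four_cycles :: "'v set set \<Rightarrow> bool" where
  "disjoint_union_of_four_cycles F \<longleftrightarrow>
     (\<exists>\<C>. (\<forall>C\<in>\<C>. four_cycle C) \<and>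
          (\<forall>C\<in>\<C>. \<forall>D\<in>\<C>. C \<noteq> D \<longrightarrow> \<Union>C \<inter> \<Union>D = {}) \<and>
          F = \<Union>\<C>)"

definition bicolor_edges :: "'v set set \<Rightarrow> ('v set \<Rightarrow> nat) \<Rightarrow> nat \<Rightarrow> nat \<Rightarrow> 'v set set" where
  "bicolor_edges E color i j = {e \<in> E. color e = i \<or> color e = j}"

text \<open>When \<open>bicolor_edges E color i j\<close> is a vertex-disjoint union of 4-cycles, the 4-cycles
  of that decomposition are exactly the 4-cycles contained in it: a 4-cycle is connected, so
  it lies within, and hence equals, one component.\<close>

definition bicolor_cycle ::
    "'v set set \<Rightarrow> ('v set \<Rightarrow> nat) \<Rightarrow> nat \<Rightarrow> nat \<Rightarrow> 'v set set \<Rightarrow> bool" where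
  "bicolor_cycle E color i j C \<longleftrightarrow> four_cycle C \<and> C \<subseteq> bicolor_edges E color i j"

text \<open>The colors are \<open>1, \<dots>, N\<close>; the bipartition consists of \<open>bosons\<close> and \<open>fermions\<close>.\<close>

locale adinkra = signed_graph V E \<mu>
  for V :: "'v set" and E :: "'v set set" and \<mu> :: "'v set \<Rightarrow> int" +
  fixes N :: nat
    and bosons fermions :: "'v set"
    and color :: "'v set \<Rightarrow> nat"
    and h :: "'v \<Rightarrow> int"
  assumes N_pos: "N \<ge> 1"
    and V_nonempty: "V \<noteq> {}"
    and bipartition: "bosons \<union> fermions = V" "bosons \<inter> fermions = {}"
    and bipartite: "e \<in> E \<Longrightarrow> \<exists>b\<in>bosons. \<exists>f\<in>fermions. e = {b, f}"
    and color_range: "e \<in> E \<Longrightarrow> color e \<in> {1..N}"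
    and one_of_each_color: "v \<in> V \<Longrightarrow> bij_betw color {e \<in> E. v \<in> e} {1..N}"
    and bicolor: "\<lbrakk>i \<in> {1..N}; j \<in> {1..N}; i \<noteq> j\<rbrakk>
      \<Longrightarrow> disjoint_union_of_four_cycles (bicolor_edges E color i j)"
    and totally_odd: "\<lbrakk>i \<in> {1..N}; j \<in> {1..N}; i \<noteq> j; bicolor_cycle E color i j C\<rbrakk>
      \<Longrightarrow> odd (card {e \<in> C. \<mu> e = -1})"
    and height: "{v, w} \<in> E \<Longrightarrow> \<bar>h v - h w\<bar> = 1"

text \<open>The list \<open>vs\<close> is the chosen ordering of the vertex set.\<close>

definition signed_adjacency_matrix ::
    "'v set set \<Rightarrow> ('v set \<Rightarrow> int) \<Rightarrow> 'v list \<Rightarrow> real mat" where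
  "signed_adjacency_matrix E \<mu> vs = mat (length vs) (length vs)
     (\<lambda>(i, j). if {vs ! i, vs ! j} \<in> E then of_int (\<mu> {vs ! i, vs ! j}) else 0)"

end

theory Submission imports Defs begin

text \<open>
  Each color \<open>i\<close> of an Adinkra gives a signed permutation operator
  \<open>\<gamma>\<^sub>i\<close> on functions on \<open>V\<close>: move along the edge of color \<open>i\<close> and
  multiply by its sign. Each edge is traversed twice in \<open>\<gamma>\<^sub>i\<^sup>2\<close>, so
  \<open>\<gamma>\<^sub>i\<^sup>2 = 1\<close>. For \<open>i \<noteq> j\<close>, the two ways of moving along color
  \<open>i\<close> and color \<open>j\<close> are the two halves of a bicolor cycle: they end at the same vertex
  because the cycle has length 4, and their signs are opposite because the number of dashed edges is
  odd (\<open>bicolor_square\<close>). So \<open>\<gamma>\<^sub>i \<gamma>\<^sub>j = - \<gamma>\<^sub>j \<gamma>\<^sub>i\<close>: the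
  colors satisfy the relations of a Clifford algebra. The adjacency matrix is the sum of all
  \<open>\<gamma>\<^sub>i\<close>, and in its square the mixed terms cancel and the \<open>N\<close> squares remain, so
  \<open>A\<^sup>2 = N I\<close> (\<open>signed_adj_square\<close>, \<open>adj_mat_square\<close>).

  This leaves the multiplicities of \<open>\<surd>N\<close> and \<open>-\<surd>N\<close>, which are equal by bipartiteness:
  conjugation by the diagonal matrix with \<open>1\<close> at bosons and \<open>-1\<close> at fermions turns \<open>A\<close>
  into \<open>-A\<close>. For the characteristic polynomial \<open>p\<close> of \<open>A\<close>, hence also of \<open>-A\<close>,
  taking determinants in \<open>(xI - A) (xI + A) = (x\<^sup>2 - N) I\<close> gives
  \<open>p\<^sup>2 = (x\<^sup>2 - N)\<^bsup>n\<^esup>\<close> with \<open>n\<close> the number of vertices. As \<open>p\<close> is monic and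
  \<open>n\<close> turns out even, \<open>p = (x\<^sup>2 - N)\<^bsup>n/2\<^esup>\<close>
  (\<open>char_poly_square_root_of_scalar\<close>). Eigenvalues and multiplicities are read off, and
  \<open>det A = (-N)\<^bsup>n/2\<^esup>\<close> from \<open>p(0)\<close>. For \<open>N > 1\<close> the sign disappears because the
  bicolor cycles of two colors partition the vertices into sets of size 4.
\<close>

section \<open>Square roots of scalar matrices with symmetric spectrum\<close>

lemma order_linear_power_mult_opposite:
  fixes s :: "'a::field_char_0"
  assumes "s \<noteq> 0"
  shows "order s ([:-s, 1:] ^ m * [:s, 1:] ^ m) = m"
proof -
  have "order s ([:s, 1:] ^ m) = 0"
    using assms by (intro order_0I) simp
  then show ?thesis
    by (subst order_mult) (simp_all add: order_power_n_n)
qed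

text \<open>Since \<open>A\<close> commutes with scalar matrices, \<open>(kI - A) (kI + A) = k\<^sup>2 I - A\<^sup>2\<close>. Taking
  determinants at every scalar \<open>k\<close> determines the product of the two polynomials, since the field
  is infinite.\<close>

lemma char_poly_times_char_poly_uminus:
  fixes A :: "'a::field_char_0 mat"
  assumes A: "A \<in> carrier_mat n n" and sq: "A * A = c \<cdot>\<^sub>m 1\<^sub>m n"
  shows "char_poly A * char_poly (- A) = [:-c, 0, 1:] ^ n"
proof -
  have "poly (char_poly A * char_poly (- A)) k = poly ([:-c, 0, 1:] ^ n) k" for k
  proof -
    let ?K = "k \<cdot>\<^sub>m 1\<^sub>m n :: 'a mat"
    have K: "?K \<in> carrier_mat n n" by simp
    have mA: "- A \<in> carrier_mat n n" using A by simp
    have minus: "- char_matrix A k = ?K - A" "- char_matrix (- A) k = ?K + A"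
      by (rule eq_matI; use A in \<open>auto simp: char_matrix_def\<close>)+
    have KA: "?K * A = k \<cdot>\<^sub>m A" "A * ?K = k \<cdot>\<^sub>m A"
      using A mult_smult_distrib[OF A one_carrier_mat] mult_smult_assoc_mat[OF one_carrier_mat A]
      by simp_all
    have "(?K - A) * (?K + A) = ?K * (?K + A) - A * (?K + A)"
      using A by (intro minus_mult_distrib_mat) auto
    also have "\<dots> = (?K * ?K + ?K * A) - (A * ?K + A * A)"
      using A by (simp add: mult_add_distrib_mat[OF K K A] mult_add_distrib_mat[OF A K A])
    also have "\<dots> = (k\<^sup>2 - c) \<cdot>\<^sub>m 1\<^sub>m n"
      unfolding KA sq by (rule eq_matI) (use A in \<open>auto simp: mult_smult_distrib[OF K one_carrier_mat] power2_eq_square\<close>)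
    finally have prod: "(?K - A) * (?K + A) = (k\<^sup>2 - c) \<cdot>\<^sub>m 1\<^sub>m n" .
    have "poly (char_poly A * char_poly (- A)) k = det (?K - A) * det (?K + A)"
      by (simp add: char_poly_matrix[OF A] char_poly_matrix[OF mA] minus)
    also have "\<dots> = det ((?K - A) * (?K + A))"
      using A by (intro det_mult[symmetric]) auto
    also have "\<dots> = (k\<^sup>2 - c) ^ n"
      unfolding prod by simp
    finally show ?thesis
      by (simp add: power2_eq_square)
  qed
  then show ?thesis
    by (simp add: poly_eq_poly_eq_iff[symmetric] fun_eq_iff)
qed

text \<open>Similarity to \<open>-A\<close> makes the product of the previous lemma a square. Evenness of \<open>n\<close> comes
  from comparing orders at \<open>\<surd>c\<close>: twice the order of the characteristic polynomial equals
  \<open>n\<close>. The square root of \<open>(x\<^sup>2 - c)\<^bsup>n\<^esup>\<close> is then determined up to sign, and the sign is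
  fixed because characteristic polynomials are monic.\<close>

lemma char_poly_square_root_of_scalar:
  fixes A :: "real mat"
  assumes A: "A \<in> carrier_mat n n" and sq: "A * A = c \<cdot>\<^sub>m 1\<^sub>m n"
    and "c > 0" and sim: "similar_mat A (- A)"
  shows "even n" "char_poly A = [:-c, 0, 1:] ^ (n div 2)"
proof -
  let ?q = "[:-c, 0, 1:]" and ?s = "sqrt c"
  have monic: "lead_coeff (char_poly A) = 1"
    using degree_monic_char_poly[OF A] by simp
  then have nonzero: "char_poly A \<noteq> 0" by auto
  have square: "char_poly A * char_poly A = ?q ^ n"
    using char_poly_times_char_poly_uminus[OF A sq] char_poly_similar[OF sim] by simp
  have "?q = [:-?s, 1:] * [:?s, 1:]"
    using \<open>c > 0\<close> by simp
  then have "order ?s (?q ^ n) = n"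
    using order_linear_power_mult_opposite[of ?s n] \<open>c > 0\<close> by (simp only: power_mult_distrib) simp
  then have "2 * order ?s (char_poly A) = n"
    using order_mult[of "char_poly A" "char_poly A" ?s] nonzero unfolding square[symmetric] by simp
  then show "even n" by (metis dvd_triv_left)
  then have "(char_poly A)\<^sup>2 = (?q ^ (n div 2))\<^sup>2"
    using square by (elim evenE) (simp add: power2_eq_square mult_2 power_add)
  then consider "char_poly A = ?q ^ (n div 2)" | "char_poly A = - (?q ^ (n div 2))"
    by (auto simp: power2_eq_iff)
  then show "char_poly A = ?q ^ (n div 2)"
  proof cases
    case 2
    have "lead_coeff (?q ^ (n div 2)) = 1"
      by (simp add: lead_coeff_power)
    then have "lead_coeff (char_poly A) = - 1"
      unfolding 2 by simp
    with monic show ?thesis by simp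
  qed
qed

lemma spectrum_of_square_root_of_scalar:
  fixes A :: "real mat"
  assumes A: "A \<in> carrier_mat n n" and "n > 0" and "c > 0"
    and "even n" and cp: "char_poly A = [:-c, 0, 1:] ^ (n div 2)"
  shows "{k. eigenvalue A k} = {sqrt c, - sqrt c}"
    and "order (sqrt c) (char_poly A) = n div 2"
    and "order (- sqrt c) (char_poly A) = n div 2"
    and "det A = (- c) ^ (n div 2)"
proof -
  let ?s = "sqrt c"
  have "n div 2 > 0" using \<open>n > 0\<close> \<open>even n\<close> by auto
  have "k * k = c \<longleftrightarrow> k = ?s \<or> k = - ?s" for k
    using \<open>c > 0\<close> power2_eq_iff[of k ?s] by (simp add: power2_eq_square)
  then show "{k. eigenvalue A k} = {?s, - ?s}"
    using \<open>n div 2 > 0\<close> by (auto simp: eigenvalue_root_char_poly[OF A] cp)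
  have factors: "char_poly A = [:-?s, 1:] ^ (n div 2) * [:?s, 1:] ^ (n div 2)"
    unfolding cp power_mult_distrib[symmetric] using \<open>c > 0\<close> by simp
  show "order ?s (char_poly A) = n div 2"
    unfolding factors using \<open>c > 0\<close> by (intro order_linear_power_mult_opposite) simp
  show "order (- ?s) (char_poly A) = n div 2"
    unfolding factors using order_linear_power_mult_opposite[of "- ?s" "n div 2"] \<open>c > 0\<close>
    by (simp add: mult.commute)
  have "- char_matrix A 0 = (- 1) \<cdot>\<^sub>m A"
    by (rule eq_matI) (use A in \<open>auto simp: char_matrix_def\<close>)
  then have "poly (char_poly A) 0 = (- 1) ^ n * det A"
    using A char_poly_matrix[OF A, of 0] by simp
  then show "det A = (- c) ^ (n div 2)"
    using \<open>even n\<close> by (simp add: cp)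
qed

section \<open>Four-cycles\<close>

lemma four_cycle_card_vertices:
  assumes "four_cycle C"
  shows "card (\<Union>C) = 4"
proof -
  obtain a b c d where "distinct [a, b, c, d]" "C = {{a, b}, {b, c}, {c, d}, {d, a}}"
    using assms unfolding four_cycle_def by blast
  moreover from this have "\<Union>C = {a, b, c, d}" by auto
  ultimately show ?thesis by simp
qed

text \<open>A 4-cycle with its starting vertex and its direction prescribed: rotating and reflecting the
  labels makes any two edges at a common vertex the first and the last.\<close>

lemma four_cycle_at_vertex:
  assumes "four_cycle C" and "{v, x} \<in> C" and "{v, y} \<in> C" and "x \<noteq> y"
  obtains z where "distinct [v, x, z, y]" and "C = {{v, x}, {x, z}, {z, y}, {y, v}}"
proof -
  obtain p q r t where pqrt: "distinct [p, q, r, t]" "C = {{p, q}, {q, r}, {r, t}, {t, p}}"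
    using assms(1) unfolding four_cycle_def by blast
  have "v \<in> {p, q, r, t}"
    using assms(2) unfolding pqrt(2) by blast
  \<comment> \<open>A rotation moves \<open>v\<close> to the front; then \<open>x\<close> and \<open>y\<close> are the second and the last vertex.\<close>
  then obtain b c d where dist: "distinct [v, b, c, d]" and C: "C = {{v, b}, {b, c}, {c, d}, {d, v}}"
  proof -
    have rotations: "C = {{q, r}, {r, t}, {t, p}, {p, q}}" "C = {{r, t}, {t, p}, {p, q}, {q, r}}"
      "C = {{t, p}, {p, q}, {q, r}, {r, t}}"
      unfolding pqrt(2) by blast+
    consider "v = p" | "v = q" | "v = r" | "v = t"
      using \<open>v \<in> {p, q, r, t}\<close> by blast
    then show thesis
    proof cases
      case 1 show thesis by (rule that[of q r t]) (use 1 pqrt in simp_all)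
    next
      case 2 show thesis by (rule that[of r t p]) (use 2 pqrt(1) rotations(1) in auto)
    next
      case 3 show thesis by (rule that[of t p q]) (use 3 pqrt(1) rotations(2) in auto)
    next
      case 4 show thesis by (rule that[of p q r]) (use 4 pqrt(1) rotations(3) in auto)
    qed
  qed
  have "x = b \<or> x = d" and "y = b \<or> y = d"
    using assms(2,3) dist unfolding C by (auto simp: doubleton_eq_iff)
  then consider "x = b" "y = d" | "x = d" "y = b"
    using \<open>x \<noteq> y\<close> by blast
  then show thesis
  proof cases
    case 1
    then show thesis using that[of c] dist C by simp
  next
    case 2
    have "C = {{v, d}, {d, c}, {c, b}, {b, v}}"
      unfolding C by (simp only: insert_commute)
    then show thesis using that[of c] dist 2 by auto
  qed
qed

section \<open>The colors of an Adinkra generate a Clifford algebra\<close>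

context adinkra
begin

definition nbr :: "nat \<Rightarrow> 'v \<Rightarrow> 'v" where
  "nbr i v = (THE w. {v, w} \<in> E \<and> color {v, w} = i)"

lemma edge_in_V: "{v, w} \<in> E \<Longrightarrow> v \<in> V \<and> w \<in> V"
  using edge by blast

lemma edge_at_vertex:
  assumes "e \<in> E" and "v \<in> e"
  obtains w where "e = {v, w}"
proof -
  have "card e = 2" using edge assms by blast
  then show thesis using assms(2) that unfolding card_2_iff by (auto simp: insert_commute)
qed

lemma edge_unique_color:
  assumes "{v, w} \<in> E" and "{v, w'} \<in> E" and "color {v, w} = color {v, w'}"
  shows "w = w'"
proof -
  have "v \<in> V" using edge_in_V assms by blast
  then have "inj_on color {e \<in> E. v \<in> e}"
    using one_of_each_color by (simp add: bij_betw_def)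
  then have "{v, w} = {v, w'}" using assms by (auto dest: inj_onD)
  then show ?thesis by (auto simp: doubleton_eq_iff)
qed

lemma nbr_eqI: "{v, w} \<in> E \<Longrightarrow> color {v, w} = i \<Longrightarrow> nbr i v = w"
  unfolding nbr_def by (rule the_equality) (auto intro: edge_unique_color)

lemma nbr_edge:
  assumes "v \<in> V" and "i \<in> {1..N}"
  shows "{v, nbr i v} \<in> E" and "color {v, nbr i v} = i"
proof -
  have "i \<in> color ` {e \<in> E. v \<in> e}"
    using one_of_each_color[OF assms(1)] assms(2) by (simp add: bij_betw_def)
  then obtain e where e: "e \<in> E" "v \<in> e" "color e = i" by auto
  obtain w where "e = {v, w}" using edge_at_vertex e by blast
  then have "{v, w} \<in> E" "color {v, w} = i" using e by auto
  with nbr_eqI show "{v, nbr i v} \<in> E" "color {v, nbr i v} = i" by auto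
qed

lemma nbr_in_V: "v \<in> V \<Longrightarrow> i \<in> {1..N} \<Longrightarrow> nbr i v \<in> V"
  using nbr_edge(1) edge_in_V by blast

lemma nbr_nbr: "v \<in> V \<Longrightarrow> i \<in> {1..N} \<Longrightarrow> nbr i (nbr i v) = v"
  using nbr_edge[of v i] by (intro nbr_eqI) (auto simp: insert_commute)

lemma bij_betw_nbr:
  assumes "v \<in> V"
  shows "bij_betw (\<lambda>i. nbr i v) {1..N} {w \<in> V. {v, w} \<in> E}"
  unfolding bij_betw_def
proof
  show "inj_on (\<lambda>i. nbr i v) {1..N}"
    by (rule inj_on_inverseI[where g = "\<lambda>w. color {v, w}"]) (rule nbr_edge(2)[OF assms])
  show "(\<lambda>i. nbr i v) ` {1..N} = {w \<in> V. {v, w} \<in> E}"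
  proof
    show "(\<lambda>i. nbr i v) ` {1..N} \<subseteq> {w \<in> V. {v, w} \<in> E}"
      using nbr_in_V[OF assms] nbr_edge(1)[OF assms] by blast
    show "{w \<in> V. {v, w} \<in> E} \<subseteq> (\<lambda>i. nbr i v) ` {1..N}"
    proof
      fix w assume "w \<in> {w \<in> V. {v, w} \<in> E}"
      then have "{v, w} \<in> E" by blast
      then show "w \<in> (\<lambda>i. nbr i v) ` {1..N}"
        by (intro image_eqI[of _ _ "color {v, w}"] color_range) (simp_all add: nbr_eqI)
    qed
  qed
qed

text \<open>The operator \<open>\<gamma>\<^sub>i\<close> of color \<open>i\<close> sends \<open>f\<close> to the function
  \<open>v \<mapsto> edge_sign i v * f (nbr i v)\<close>.\<close>

definition edge_sign :: "nat \<Rightarrow> 'v \<Rightarrow> real" where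
  "edge_sign i v = of_int (\<mu> {v, nbr i v})"

text \<open>The adjacency matrix indexed by the vertices themselves, so that sums over \<open>V\<close> can be
  handled before an ordering is chosen.\<close>

definition signed_adj :: "'v \<Rightarrow> 'v \<Rightarrow> real" where
  "signed_adj v w = (if {v, w} \<in> E then of_int (\<mu> {v, w}) else 0)"

lemma prod_signature:
  assumes "finite C" and "C \<subseteq> E"
  shows "(\<Prod>e\<in>C. \<mu> e) = (- 1) ^ card {e \<in> C. \<mu> e = - 1}"
proof -
  have "(\<Prod>e\<in>C. \<mu> e) = (\<Prod>e\<in>C. if \<mu> e = - 1 then - 1 else 1)"
    using assms signature by (intro prod.cong) auto
  also have "\<dots> = (\<Prod>e\<in>{e \<in> C. \<mu> e = - 1}. - 1)"
    using assms by (subst prod.inter_filter) auto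
  finally show ?thesis by simp
qed

text \<open>The relation \<open>\<gamma>\<^sub>i \<gamma>\<^sub>j = - \<gamma>\<^sub>j \<gamma>\<^sub>i\<close>. The edges of colors \<open>i\<close> and
  \<open>j\<close> at \<open>v\<close> lie in the same component, a 4-cycle \<open>v, x, z, y\<close>. The two paths from
  \<open>v\<close> to \<open>z\<close> together use each of its edges once, and the product of the four signs is
  \<open>-1\<close> by total oddness.\<close>

lemma bicolor_square:
  assumes v: "v \<in> V" and ij: "i \<in> {1..N}" "j \<in> {1..N}" "i \<noteq> j"
  shows "nbr j (nbr i v) = nbr i (nbr j v)"
    and "edge_sign i v * edge_sign j (nbr i v) = - (edge_sign j v * edge_sign i (nbr j v))"
proof -
  define x y where "x = nbr i v" and "y = nbr j v"
  have ex: "{v, x} \<in> E" "color {v, x} = i" and ey: "{v, y} \<in> E" "color {v, y} = j"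
    using nbr_edge v ij by (auto simp: x_def y_def)
  let ?F = "bicolor_edges E color i j"
  have F: "{v, x} \<in> ?F" "{v, y} \<in> ?F" using ex ey by (auto simp: bicolor_edges_def)
  obtain \<C> where cyc: "\<forall>C\<in>\<C>. four_cycle C"
    and disj: "\<forall>C\<in>\<C>. \<forall>D\<in>\<C>. C \<noteq> D \<longrightarrow> \<Union>C \<inter> \<Union>D = {}" and un: "?F = \<Union>\<C>"
    using bicolor[OF ij] unfolding disjoint_union_of_four_cycles_def by blast
  obtain C D where CD: "C \<in> \<C>" "{v, x} \<in> C" "D \<in> \<C>" "{v, y} \<in> D"
    using F un by auto
  have "v \<in> \<Union>C \<inter> \<Union>D" using CD by blast
  then have "C = D" using disj CD by blast
  have "x \<noteq> y" using ex ey ij by auto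
  obtain z where dist: "distinct [v, x, z, y]" and C: "C = {{v, x}, {x, z}, {z, y}, {y, v}}"
    using four_cycle_at_vertex cyc CD \<open>C = D\<close> \<open>x \<noteq> y\<close> by metis
  have "C \<subseteq> ?F" using CD un by auto
  then have "C \<subseteq> E" by (auto simp: bicolor_edges_def)
  \<comment> \<open>Colors alternate along the cycle because no vertex meets two edges of one color.\<close>
  have xz: "{x, z} \<in> E" "color {x, z} = j"
  proof -
    show "{x, z} \<in> E" using \<open>C \<subseteq> E\<close> C by auto
    moreover have "color {x, z} \<noteq> i"
      using edge_unique_color[of x z v] ex dist \<open>{x, z} \<in> E\<close> by (auto simp: insert_commute)
    ultimately show "color {x, z} = j"
      using \<open>C \<subseteq> ?F\<close> C by (auto simp: bicolor_edges_def)
  qed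
  have yz: "{y, z} \<in> E" "color {y, z} = i"
  proof -
    show "{y, z} \<in> E" using \<open>C \<subseteq> E\<close> C by (auto simp: insert_commute)
    moreover have "color {y, z} \<noteq> j"
      using edge_unique_color[of y z v] ey dist \<open>{y, z} \<in> E\<close> by (auto simp: insert_commute)
    ultimately show "color {y, z} = i"
      using \<open>C \<subseteq> ?F\<close> C by (auto simp: bicolor_edges_def insert_commute)
  qed
  have nx: "nbr j x = z" and ny: "nbr i y = z" using nbr_eqI xz yz by auto
  then show "nbr j (nbr i v) = nbr i (nbr j v)" by (simp add: x_def y_def)
  have "odd (card {e \<in> C. \<mu> e = - 1})"
    using totally_odd[OF ij] cyc CD(1) \<open>C \<subseteq> ?F\<close> by (auto simp: bicolor_cycle_def)
  then have "(\<Prod>e\<in>C. \<mu> e) = - 1"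
    using prod_signature[OF _ \<open>C \<subseteq> E\<close>] C by simp
  moreover have "(\<Prod>e\<in>C. \<mu> e) = \<mu> {v, x} * (\<mu> {x, z} * (\<mu> {y, z} * \<mu> {v, y}))"
    unfolding C using dist by (auto simp: doubleton_eq_iff insert_commute)
  ultimately have "\<mu> {v, x} * (\<mu> {x, z} * (\<mu> {y, z} * \<mu> {v, y})) = - 1"
    by simp
  then have "\<mu> {v, x} * \<mu> {x, z} = - (\<mu> {v, y} * \<mu> {y, z})"
    using signature[OF ex(1)] signature[OF ey(1)] signature[OF xz(1)] signature[OF yz(1)] by auto
  then show "edge_sign i v * edge_sign j (nbr i v) = - (edge_sign j v * edge_sign i (nbr j v))"
    unfolding edge_sign_def using nx ny unfolding x_def y_def
    by (simp flip: of_int_mult of_int_minus)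
qed

text \<open>The relation \<open>\<gamma>\<^sub>i\<^sup>2 = 1\<close>.\<close>

lemma edge_sign_nbr_self:
  assumes "v \<in> V" and "i \<in> {1..N}"
  shows "edge_sign i v * edge_sign i (nbr i v) = 1"
  using signature[OF nbr_edge(1)[OF assms]]
  by (auto simp: edge_sign_def nbr_nbr[OF assms] insert_commute)

text \<open>The adjacency operator is the sum of the \<open>\<gamma>\<^sub>i\<close>, since the edges at a vertex are indexed
  by their colors.\<close>

lemma signed_adj_apply:
  assumes "v \<in> V"
  shows "(\<Sum>w\<in>V. signed_adj v w * f w) = (\<Sum>i = 1..N. edge_sign i v * f (nbr i v))"
proof -
  have "(\<Sum>w\<in>V. signed_adj v w * f w) = (\<Sum>w | w \<in> V \<and> {v, w} \<in> E. signed_adj v w * f w)"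
    using finite_V by (intro sum.mono_neutral_right) (auto simp: signed_adj_def)
  also have "\<dots> = (\<Sum>i = 1..N. signed_adj v (nbr i v) * f (nbr i v))"
    by (rule sum.reindex_bij_betw[OF bij_betw_nbr[OF assms], symmetric])
  finally show ?thesis
    using nbr_edge(1)[OF assms] by (simp add: signed_adj_def edge_sign_def)
qed

text \<open>The square of \<open>\<Sum>\<^sub>i \<gamma>\<^sub>i\<close> is evaluated by adding the double sum to its transpose: the pair
  \<open>i, j\<close> then contributes the anticommutator of \<open>\<gamma>\<^sub>i\<close> and \<open>\<gamma>\<^sub>j\<close>, which is
  \<open>2\<close> for \<open>i = j\<close> and \<open>0\<close> otherwise.\<close>

lemma signed_adj_square:
  assumes u: "u \<in> V" and w: "w \<in> V"
  shows "(\<Sum>v\<in>V. signed_adj u v * signed_adj v w) = (if u = w then real N else 0)"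
proof -
  define t where
    "t i j = edge_sign i u * edge_sign j (nbr i u) * of_bool (nbr j (nbr i u) = w)" for i j
  have entry: "signed_adj v w = (\<Sum>j = 1..N. edge_sign j v * of_bool (nbr j v = w))" if "v \<in> V" for v
    using signed_adj_apply[OF that, of "\<lambda>x. of_bool (x = w)"] w finite_V by simp
  have "(\<Sum>v\<in>V. signed_adj u v * signed_adj v w)
      = (\<Sum>i = 1..N. edge_sign i u * signed_adj (nbr i u) w)"
    by (rule signed_adj_apply[OF u])
  also have "\<dots> = (\<Sum>i = 1..N. \<Sum>j = 1..N. t i j)"
    using entry[OF nbr_in_V[OF u]] by (simp add: t_def sum_distrib_left mult.assoc del: sum_mult_of_bool_eq)
  finally have sum: "(\<Sum>v\<in>V. signed_adj u v * signed_adj v w) = (\<Sum>i = 1..N. \<Sum>j = 1..N. t i j)" .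
  \<comment> \<open>The Clifford relations, read in row \<open>u\<close> and column \<open>w\<close>.\<close>
  have clifford: "t i j + t j i = (if i = j then 2 * of_bool (u = w) else 0)"
    if "i \<in> {1..N}" "j \<in> {1..N}" for i j
    using that bicolor_square[OF u that] edge_sign_nbr_self[OF u that(1)] nbr_nbr[OF u that(1)]
    by (auto simp: t_def)
  have "2 * (\<Sum>i = 1..N. \<Sum>j = 1..N. t i j)
      = (\<Sum>i = 1..N. \<Sum>j = 1..N. t i j) + (\<Sum>i = 1..N. \<Sum>j = 1..N. t j i)"
    by (subst sum.swap) simp
  also have "\<dots> = (\<Sum>i = 1..N. \<Sum>j = 1..N. t i j + t j i)"
    by (simp add: sum.distrib)
  also have "\<dots> = (\<Sum>i = 1..N. \<Sum>j = 1..N. if i = j then 2 * of_bool (u = w) else 0)"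
    using clifford by (intro sum.cong refl)
  also have "\<dots> = 2 * (if u = w then real N else 0)"
    by simp
  finally show ?thesis using sum by simp
qed

lemma edge_bosons_iff:
  assumes "{v, w} \<in> E"
  shows "v \<in> bosons \<longleftrightarrow> w \<notin> bosons"
  using bipartite[OF assms] bipartition by (auto simp: doubleton_eq_iff)

text \<open>Every vertex has an edge of color 1, so the cycles of colors 1 and 2 cover \<open>V\<close>.\<close>

lemma four_dvd_card_V:
  assumes "N > 1"
  shows "4 dvd card V"
proof -
  have ij: "1 \<in> {1..N}" "2 \<in> {1..N}" "(1::nat) \<noteq> 2" using assms by auto
  let ?F = "bicolor_edges E color 1 2"
  obtain \<C> where cyc: "\<forall>C\<in>\<C>. four_cycle C"
    and disj: "\<forall>C\<in>\<C>. \<forall>D\<in>\<C>. C \<noteq> D \<longrightarrow> \<Union>C \<inter> \<Union>D = {}" and un: "?F = \<Union>\<C>"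
    using bicolor[OF ij] unfolding disjoint_union_of_four_cycles_def by blast
  have "\<Union>?F \<subseteq> V" using edge by (auto simp: bicolor_edges_def)
  moreover have "V \<subseteq> \<Union>?F"
    using nbr_edge[OF _ ij(1)] by (force simp: bicolor_edges_def)
  ultimately have V: "V = \<Union>(Union ` \<C>)" using un by auto
  show ?thesis
    unfolding V
  proof (rule dvd_partition)
    show "finite (\<Union>(Union ` \<C>))" using finite_V V by simp
    show "\<forall>c\<in>Union ` \<C>. 4 dvd card c" using cyc by (simp add: four_cycle_card_vertices)
    show "\<forall>c1\<in>Union ` \<C>. \<forall>c2\<in>Union ` \<C>. c1 \<noteq> c2 \<longrightarrow> c1 \<inter> c2 = {}" using disj by blast
  qed
qed

context
  fixes vs :: "'v list"
  assumes distinct_vs: "distinct vs" and set_vs: "set vs = V"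
begin

abbreviation adj_mat :: "real mat" where
  "adj_mat \<equiv> signed_adjacency_matrix E \<mu> vs"

lemma length_vs: "length vs = card V"
  using distinct_card[OF distinct_vs] set_vs by simp

lemma adj_mat_carrier: "adj_mat \<in> carrier_mat (card V) (card V)"
  by (simp add: signed_adjacency_matrix_def length_vs)

lemma adj_mat_index:
  "r < card V \<Longrightarrow> s < card V \<Longrightarrow> adj_mat $$ (r, s) = signed_adj (vs ! r) (vs ! s)"
  by (simp add: signed_adjacency_matrix_def signed_adj_def length_vs)

lemma adj_mat_square: "adj_mat * adj_mat = real N \<cdot>\<^sub>m 1\<^sub>m (card V)"
proof (rule eq_matI)
  fix r s assume "r < dim_row (real N \<cdot>\<^sub>m 1\<^sub>m (card V))" "s < dim_col (real N \<cdot>\<^sub>m 1\<^sub>m (card V))"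
  then have r: "r < card V" and s: "s < card V" by auto
  have rs: "vs ! r \<in> V" "vs ! s \<in> V" "vs ! r = vs ! s \<longleftrightarrow> r = s"
    using r s distinct_vs set_vs length_vs by (auto simp: nth_eq_iff_index_eq)
  have "(adj_mat * adj_mat) $$ (r, s) = (\<Sum>k<card V. adj_mat $$ (r, k) * adj_mat $$ (k, s))"
    using r s adj_mat_carrier by (simp add: scalar_prod_def atLeast0LessThan)
  also have "\<dots> = (\<Sum>k<card V. signed_adj (vs ! r) (vs ! k) * signed_adj (vs ! k) (vs ! s))"
    using r s by (simp add: adj_mat_index)
  also have "\<dots> = (\<Sum>v\<in>V. signed_adj (vs ! r) v * signed_adj v (vs ! s))"
    by (rule sum.reindex_bij_betw) (use bij_betw_nth[OF distinct_vs] set_vs length_vs in auto)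
  also have "\<dots> = (real N \<cdot>\<^sub>m 1\<^sub>m (card V)) $$ (r, s)"
    using signed_adj_square[OF rs(1,2)] rs(3) r s by simp
  finally show "(adj_mat * adj_mat) $$ (r, s) = (real N \<cdot>\<^sub>m 1\<^sub>m (card V)) $$ (r, s)" .
qed (use adj_mat_carrier in auto)

text \<open>An entry of \<open>A\<close> can be nonzero only between a boson and a fermion, so changing the sign of all
  fermions negates it.\<close>

lemma adj_mat_similar_uminus: "similar_mat adj_mat (- adj_mat)"
proof -
  define D where "D = mat_diag (card V) (\<lambda>r. if vs ! r \<in> bosons then 1 else - 1 :: real)"
  have D: "D \<in> carrier_mat (card V) (card V)" by (simp add: D_def)
  have mA: "- adj_mat \<in> carrier_mat (card V) (card V)" using adj_mat_carrier by simp
  have DD: "D * D = 1\<^sub>m (card V)"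
    unfolding D_def mat_diag_diag by (rule eq_matI) (auto simp: mat_diag_def)
  have "adj_mat = D * (- adj_mat) * D"
    unfolding D_def mat_diag_mult_left[OF mA]
    by (subst mat_diag_mult_right[of _ "card V"], simp, rule eq_matI)
      (use adj_mat_carrier edge_bosons_iff in \<open>auto simp: adj_mat_index signed_adj_def\<close>)
  then show ?thesis
    using D DD mA adj_mat_carrier
    by (intro similar_matI[of _ _ D D "card V"]) auto
qed

end

end

section \<open>The spectrum of an Adinkra\<close>

theorem theorem9:
  fixes V :: "'v set" and E :: "'v set set" and \<mu> :: "'v set \<Rightarrow> int"
    and N :: nat and bosons fermions :: "'v set"
    and color :: "'v set \<Rightarrow> nat" and h :: "'v \<Rightarrow> int"
    and vs :: "'v list" and A :: "real mat"
  assumes "adinkra V E \<mu> N bosons fermions color h"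
    and "distinct vs" and "set vs = V"
    and "A = signed_adjacency_matrix E \<mu> vs"
  shows "{k. eigenvalue A k} = {sqrt (real N), - sqrt (real N)}
    \<and> real (Polynomial.order (sqrt (real N)) (char_poly A)) = real (card V) / 2
    \<and> real (Polynomial.order (- sqrt (real N)) (char_poly A)) = real (card V) / 2
    \<and> A ^\<^sub>m 2 = real N \<cdot>\<^sub>m 1\<^sub>m (card V)
    \<and> (N > 1 \<longrightarrow> det A = real N ^ (card V div 2))
    \<and> (N = 1 \<longrightarrow> det A = (-1) ^ (card V div 2))"
proof -
  interpret adinkra V E \<mu> N bosons fermions color h by (fact assms(1))
  have A: "A \<in> carrier_mat (card V) (card V)"
    and square: "A * A = real N \<cdot>\<^sub>m 1\<^sub>m (card V)"
    and sim: "similar_mat A (- A)"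
    using adj_mat_carrier adj_mat_square adj_mat_similar_uminus assms(2-4) by auto
  have "card V > 0" using finite_V V_nonempty by (simp add: card_gt_0_iff)
  have "real N > 0" using N_pos by simp
  note cp = char_poly_square_root_of_scalar[OF A square \<open>real N > 0\<close> sim]
  note spec = spectrum_of_square_root_of_scalar[OF A \<open>card V > 0\<close> \<open>real N > 0\<close> cp]
  have half: "real (card V div 2) = real (card V) / 2"
    using cp(1) by auto
  have "A ^\<^sub>m 2 = real N \<cdot>\<^sub>m 1\<^sub>m (card V)"
    using A square by (simp add: numeral_2_eq_2)
  moreover have "det A = real N ^ (card V div 2)" if "N > 1"
  proof -
    have "even (card V div 2)"
      using four_dvd_card_V[OF that] by (auto elim!: dvdE)
    then show ?thesis using spec(4) by simp
  qed
  moreover have "det A = (- 1) ^ (card V div 2)" if "N = 1"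
    using spec(4) that by simp
  ultimately show ?thesis
    using spec(1-3) half by auto
qed

end
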